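(* Let $n\ge 1$ be an integer, let $A,B\in M_n(\mathbb{R})$ and let $\mathcal{M}=A+B\epsilon\in M_n(\mathbb{D})$. Then $\mathcal{M}$ is nil-clean in $M_n(\mathbb{D})$ if and only if $A$ is nil-clean in $M_n(\mathbb{R})$.
   Context: $\mathbb{D}=\{a+b\epsilon \mid a,b\in\mathbb{R},\ \epsilon^2=0\}$ is the ring of dual numbers. $M_n(\mathbb{D})$ is the ring of $n\times n$ matrices over $\mathbb{D}$; each element is uniquely of the form $A+B\epsilon$ with $A,B\in M_n(\mathbb{R})$. An element $a$ of a ring $R$ (associative with identity) is nil-clean if $a=e+t$ where $e\in R$ is idempotent and $t\in R$ is nilpotent. *)

theory Defs
  imports Complex_Main "Jordan_Normal_Form.Matrix"
begin

datatype dual_number = Dual (std_part: real) (eps_part: real)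

lemma dual_number_eq_iff:
  "x = y \<longleftrightarrow> std_part x = std_part y \<and> eps_part x = eps_part y"
  by (cases x; cases y) simp

instantiation dual_number :: comm_ring_1
begin

definition "0 = Dual 0 0"
definition "1 = Dual 1 0"
definition "x + y = Dual (std_part x + std_part y) (eps_part x + eps_part y)"
definition "- x = Dual (- std_part x) (- eps_part x)"
definition "x - y = Dual (std_part x - std_part y) (eps_part x - eps_part y)"
definition "x * y =
  Dual (std_part x * std_part y) (std_part x * eps_part y + eps_part x * std_part y)"

instance
  by standard
    (simp_all add: zero_dual_number_def one_dual_number_def plus_dual_number_def
      uminus_dual_number_def minus_dual_number_def times_dual_number_def algebra_simps)

end

instantiation dual_number :: real_algebra_1
begin

definition "r *\<^sub>R x = Dual (r * std_part x) (r * eps_part x)"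

instance
  by standard
    (simp_all add: scaleR_dual_number_def plus_dual_number_def times_dual_number_def
      dual_number_eq_iff algebra_simps)

end

definition eps :: dual_number where
  "eps = Dual 0 1"

lemma eps_squared: "eps ^ 2 = 0"
  by (simp add: eps_def power2_eq_square times_dual_number_def zero_dual_number_def)

lemma Dual_eq: "Dual a b = of_real a + of_real b * eps"
  by (simp add: of_real_def scaleR_dual_number_def one_dual_number_def eps_def
      plus_dual_number_def times_dual_number_def)

abbreviation matrix_ring :: "'a::comm_ring_1 itself \<Rightarrow> nat \<Rightarrow> 'a mat ring" where
  "matrix_ring ty n \<equiv> ring_mat ty n ()"

definition dual_mat :: "real mat \<Rightarrow> real mat \<Rightarrow> dual_number mat" where
  "dual_mat A B = map_mat of_real A + eps \<cdot>\<^sub>m map_mat of_real B"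

lemma dual_mat_carrier:
  "A \<in> carrier_mat n n \<Longrightarrow> B \<in> carrier_mat n n \<Longrightarrow> dual_mat A B \<in> carrier_mat n n"
  by (simp add: dual_mat_def)

lemma dual_mat_index:
  assumes "A \<in> carrier_mat n n" "B \<in> carrier_mat n n" "i < n" "j < n"
  shows "dual_mat A B $$ (i, j) = Dual (A $$ (i, j)) (B $$ (i, j))"
  using assms by (simp add: dual_mat_def Dual_eq mult.commute)

lemma dual_mat_decomposition:
  assumes M: "M \<in> carrier_mat n n"
  shows "\<exists>!(A, B). A \<in> carrier_mat n n \<and> B \<in> carrier_mat n n \<and> M = dual_mat A B"
proof (rule ex1I[of _ "(map_mat std_part M, map_mat eps_part M)"])
  have "M = dual_mat (map_mat std_part M) (map_mat eps_part M)"
  proof (rule eq_matI)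
    fix i j
    assume "i < dim_row (dual_mat (map_mat std_part M) (map_mat eps_part M))"
      and "j < dim_col (dual_mat (map_mat std_part M) (map_mat eps_part M))"
    then have ij: "i < n" "j < n"
      using M by (auto simp: dual_mat_def)
    then show "M $$ (i, j) = dual_mat (map_mat std_part M) (map_mat eps_part M) $$ (i, j)"
      using M by (subst dual_mat_index[of _ n]) auto
  qed (auto simp: dual_mat_def)
  then show "case (map_mat std_part M, map_mat eps_part M) of
      (A, B) \<Rightarrow> A \<in> carrier_mat n n \<and> B \<in> carrier_mat n n \<and> M = dual_mat A B"
    using M by simp
next
  fix p
  assume p: "case p of (A, B) \<Rightarrow>
    A \<in> carrier_mat n n \<and> B \<in> carrier_mat n n \<and> M = dual_mat A B"
  obtain A B where AB: "p = (A, B)" by (cases p)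
  with p have c: "A \<in> carrier_mat n n" "B \<in> carrier_mat n n" and Meq: "M = dual_mat A B"
    by auto
  have "A = map_mat std_part M" "B = map_mat eps_part M"
    using c M by (auto intro!: eq_matI simp: Meq dual_mat_index[OF c] dual_mat_def Dual_eq[symmetric] mult.commute[of eps])
  then show "p = (map_mat std_part M, map_mat eps_part M)"
    by (simp add: AB)
qed

definition idempotent_elem :: "('a, 'b) ring_scheme \<Rightarrow> 'a \<Rightarrow> bool" where
  "idempotent_elem R e \<longleftrightarrow> e \<in> carrier R \<and> e \<otimes>\<^bsub>R\<^esub> e = e"

definition nilpotent_elem :: "('a, 'b) ring_scheme \<Rightarrow> 'a \<Rightarrow> bool" where
  "nilpotent_elem R t \<longleftrightarrow> t \<in> carrier R \<and> (\<exists>k::nat. k \<ge> 1 \<and> t [^]\<^bsub>R\<^esub> k = \<zero>\<^bsub>R\<^esub>)"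

definition nil_clean :: "('a, 'b) ring_scheme \<Rightarrow> 'a \<Rightarrow> bool" where
  "nil_clean R a \<longleftrightarrow>
    (\<exists>e t. idempotent_elem R e \<and> nilpotent_elem R t \<and> a = e \<oplus>\<^bsub>R\<^esub> t)"

end

(* Taking standard parts is a split surjection M_n(D) -> M_n(R) whose kernel has square zero.
   Given A = e + t, lift the idempotent e along the splitting; the difference of A + B eps and
   the lift maps to t, so a power of it lies in the kernel and the square of that power is 0. *)
theory Submission
  imports Defs "HOL-Algebra.RingHom"
begin

lemma ring_hom_nilpotent_elem:
  assumes "ring R" "ring S" "h \<in> ring_hom R S" "nilpotent_elem R t"
  shows "nilpotent_elem S (h t)"
proof -
  obtain k :: nat where k: "k \<ge> 1" "t \<in> carrier R" "t [^]\<^bsub>R\<^esub> k = \<zero>\<^bsub>R\<^esub>"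
    using assms(4) unfolding nilpotent_elem_def by blast
  have "h t [^]\<^bsub>S\<^esub> k = \<zero>\<^bsub>S\<^esub>"
    using ring_hom_ring.hom_nat_pow[OF ring_hom_ringI2[OF assms(1-3)] k(2), of k]
      k(3) ring_hom_zero[OF assms(3,1,2)] by simp
  with k ring_hom_closed[OF assms(3)] show ?thesis
    unfolding nilpotent_elem_def by blast
qed

lemma ring_hom_idempotent_elem:
  assumes "h \<in> ring_hom R S" "idempotent_elem R e"
  shows "idempotent_elem S (h e)"
  using assms ring_hom_closed[OF assms(1)] ring_hom_mult[OF assms(1)]
  unfolding idempotent_elem_def by metis

text \<open>The two summands of a decomposition can be mapped separately, since homomorphisms
  preserve idempotents and nilpotents. With \<open>h\<close> the standard part map this is the
  forward direction.\<close>

lemma ring_hom_nil_clean: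
  assumes "ring R" "ring S" "h \<in> ring_hom R S" "nil_clean R a"
  shows "nil_clean S (h a)"
proof -
  obtain e t where et: "idempotent_elem R e" "nilpotent_elem R t" "a = e \<oplus>\<^bsub>R\<^esub> t"
    using assms(4) unfolding nil_clean_def by blast
  have "h a = h e \<oplus>\<^bsub>S\<^esub> h t"
    using et ring_hom_add[OF assms(3)] unfolding idempotent_elem_def nilpotent_elem_def by blast
  with ring_hom_idempotent_elem[OF assms(3) et(1)] ring_hom_nilpotent_elem[OF assms(1-3) et(2)]
  show ?thesis unfolding nil_clean_def by blast
qed

lemma nilpotent_elem_lift:
  assumes "ring R" "ring S" "h \<in> ring_hom R S"
    and square_zero: "\<And>x y. x \<in> carrier R \<Longrightarrow> y \<in> carrier R \<Longrightarrow>
      h x = \<zero>\<^bsub>S\<^esub> \<Longrightarrow> h y = \<zero>\<^bsub>S\<^esub> \<Longrightarrow> x \<otimes>\<^bsub>R\<^esub> y = \<zero>\<^bsub>R\<^esub>"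
    and "t \<in> carrier R" "nilpotent_elem S (h t)"
  shows "nilpotent_elem R t"
proof -
  interpret R: ring R by fact
  obtain k :: nat where k: "k \<ge> 1" "h t [^]\<^bsub>S\<^esub> k = \<zero>\<^bsub>S\<^esub>"
    using assms(6) unfolding nilpotent_elem_def by blast
  have "h (t [^]\<^bsub>R\<^esub> k) = \<zero>\<^bsub>S\<^esub>"
    using ring_hom_ring.hom_nat_pow[OF ring_hom_ringI2[OF assms(1-3)] assms(5)] k(2) by simp
  \<comment> \<open>Apply \<open>square_zero\<close> with both factors equal to the kernel element
    \<open>t [^] k\<close>.\<close>
  then have "t [^]\<^bsub>R\<^esub> (k + k) = \<zero>\<^bsub>R\<^esub>"
    using square_zero assms(5) by (simp add: R.nat_pow_mult[symmetric])
  then show ?thesis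
    using k(1) assms(5) unfolding nilpotent_elem_def by (metis trans_le_add1)
qed

text \<open>Working with abstract rings confines matrix computations to checking the hypotheses on
  \<open>h\<close> and \<open>s\<close>. Because the section \<open>s\<close> is multiplicative,
  \<open>s e\<close> is an idempotent over \<open>e\<close>, so no iterative lifting of idempotents
  is required.\<close>

lemma nil_clean_split_square_zero_extension:
  assumes "ring R" "ring S" "h \<in> ring_hom R S" "s \<in> ring_hom S R"
    and section_of_h: "\<And>x. x \<in> carrier S \<Longrightarrow> h (s x) = x"
    and square_zero: "\<And>x y. x \<in> carrier R \<Longrightarrow> y \<in> carrier R \<Longrightarrow>
      h x = \<zero>\<^bsub>S\<^esub> \<Longrightarrow> h y = \<zero>\<^bsub>S\<^esub> \<Longrightarrow> x \<otimes>\<^bsub>R\<^esub> y = \<zero>\<^bsub>R\<^esub>"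
    and a: "a \<in> carrier R"
  shows "nil_clean R a \<longleftrightarrow> nil_clean S (h a)"
proof
  show "nil_clean R a \<Longrightarrow> nil_clean S (h a)"
    using ring_hom_nil_clean[OF assms(1-3)] .
next
  interpret R: ring R by fact
  interpret S: ring S by fact
  interpret h: ring_hom_ring R S h
    using assms(1-3) by (rule ring_hom_ringI2)
  assume "nil_clean S (h a)"
  then obtain e t where et: "idempotent_elem S e" "nilpotent_elem S t" "h a = e \<oplus>\<^bsub>S\<^esub> t"
    unfolding nil_clean_def by blast
  then have carr: "e \<in> carrier S" "t \<in> carrier S"
    unfolding idempotent_elem_def nilpotent_elem_def by auto
  then have se: "s e \<in> carrier R"
    using ring_hom_closed[OF assms(4)] by blast
  \<comment> \<open>Writing \<open>h a\<close> as \<open>t\<close> plus \<open>e\<close>, in this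
    order, lets \<open>e\<close> cancel by associativity alone.\<close>
  have "h (a \<ominus>\<^bsub>R\<^esub> s e) = (t \<oplus>\<^bsub>S\<^esub> e) \<oplus>\<^bsub>S\<^esub> \<ominus>\<^bsub>S\<^esub> e"
    using a se carr by (simp add: a_minus_def et(3) section_of_h S.a_comm)
  also have "\<dots> = t \<oplus>\<^bsub>S\<^esub> (e \<oplus>\<^bsub>S\<^esub> \<ominus>\<^bsub>S\<^esub> e)"
    using carr by (intro S.a_assoc) simp_all
  also have "\<dots> = t"
    using carr by (simp add: S.r_neg)
  finally have "nilpotent_elem S (h (a \<ominus>\<^bsub>R\<^esub> s e))"
    using et(2) by (rule ssubst)
  then have "nilpotent_elem R (a \<ominus>\<^bsub>R\<^esub> s e)"
    using nilpotent_elem_lift[OF assms(1-3)] square_zero R.minus_closed[OF a se] by blast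
  moreover have "a = s e \<oplus>\<^bsub>R\<^esub> (a \<ominus>\<^bsub>R\<^esub> s e)"
  proof -
    have "s e \<oplus>\<^bsub>R\<^esub> (a \<ominus>\<^bsub>R\<^esub> s e) = a \<oplus>\<^bsub>R\<^esub> (s e \<oplus>\<^bsub>R\<^esub> \<ominus>\<^bsub>R\<^esub> s e)"
      unfolding a_minus_def using a se by (intro R.a_lcomm) simp_all
    then show ?thesis
      using a se by (simp add: R.r_neg)
  qed
  ultimately show "nil_clean R a"
    using ring_hom_idempotent_elem[OF assms(4) et(1)] unfolding nil_clean_def by blast
qed

text \<open>Serves twice: with \<open>std_part\<close> it yields the projection, with
  \<open>of_real\<close> its section.\<close>

lemma map_mat_ring_hom:
  fixes f :: "'a::comm_ring_1 \<Rightarrow> 'b::comm_ring_1"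
  assumes "comm_ring_hom f"
  shows "map_mat f \<in> ring_hom (matrix_ring TYPE('a) n) (matrix_ring TYPE('b) n)"
proof -
  interpret f: comm_ring_hom f by fact
  show ?thesis
    by (auto intro!: ring_hom_memI eq_matI simp: ring_mat_simps f.mat_hom_mult f.mat_hom_one
        f.hom_add)
qed

lemma comm_ring_hom_std_part: "comm_ring_hom std_part"
  by unfold_locales
    (simp_all add: zero_dual_number_def one_dual_number_def plus_dual_number_def
      times_dual_number_def)

text \<open>At the type \<open>dual_number\<close> this is the embedding of \<open>r\<close> as
  \<open>Dual r 0\<close>, which splits \<open>std_part\<close>.\<close>

lemma comm_ring_hom_of_real:
  "comm_ring_hom (of_real :: real \<Rightarrow> 'a::{real_algebra_1,comm_ring_1})"
  by unfold_locales simp_all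

lemma std_part_of_real: "std_part (of_real x) = x"
  by (simp add: of_real_def scaleR_dual_number_def one_dual_number_def)

text \<open>All entries of both matrices are real multiples of \<open>eps\<close>, so every summand
  of an entry of the product contains the factor \<open>eps ^ 2 = 0\<close>.\<close>

lemma mult_mat_eq_0_if_std_part_0:
  assumes "M \<in> carrier_mat n n" "N \<in> carrier_mat n n"
    and M: "map_mat std_part M = 0\<^sub>m n n" and N: "map_mat std_part N = 0\<^sub>m n n"
  shows "M * N = 0\<^sub>m n n"
proof (rule eq_matI)
  fix i j assume "i < dim_row (0\<^sub>m n n)" "j < dim_col (0\<^sub>m n n)"
  then have ij: "i < n" "j < n" by auto
  have z: "M $$ (i, k) * N $$ (k, j) = 0" if "k < n" for k
  proof -
    have "std_part (M $$ (i, k)) = 0" "std_part (N $$ (k, j)) = 0"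
      using arg_cong[OF M, of "\<lambda>X. X $$ (i, k)"] arg_cong[OF N, of "\<lambda>X. X $$ (k, j)"]
        assms(1,2) ij that by auto
    then show ?thesis by (simp add: times_dual_number_def zero_dual_number_def)
  qed
  show "(M * N) $$ (i, j) = 0\<^sub>m n n $$ (i, j)"
    using assms(1,2) ij by (auto simp: scalar_prod_def z intro!: sum.neutral)
qed (use assms in auto)

theorem theorem4p3:
  fixes n :: nat and A B :: "real mat"
  assumes "n \<ge> 1"
    and "A \<in> carrier_mat n n"
    and "B \<in> carrier_mat n n"
  shows "nil_clean (matrix_ring TYPE(dual_number) n) (dual_mat A B) \<longleftrightarrow>
    nil_clean (matrix_ring TYPE(real) n) A"
proof -
  have "map_mat std_part (dual_mat A B) = A"
    using assms(2,3) dual_mat_carrier[OF assms(2,3)]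
    by (auto intro!: eq_matI simp: dual_mat_index[OF assms(2,3)])
  moreover have "nil_clean (matrix_ring TYPE(dual_number) n) (dual_mat A B) \<longleftrightarrow>
      nil_clean (matrix_ring TYPE(real) n) (map_mat std_part (dual_mat A B))"
    \<comment> \<open>Here \<open>h\<close> is \<open>map_mat std_part\<close> and \<open>s\<close>
      is \<open>map_mat of_real\<close>. What remains is the section identity, the vanishing of
      products in the kernel, and membership of \<open>dual_mat A B\<close> in the carrier.\<close>
    by (rule nil_clean_split_square_zero_extension[OF ring_mat ring_mat
          map_mat_ring_hom[OF comm_ring_hom_std_part] map_mat_ring_hom[OF comm_ring_hom_of_real]])
      (use dual_mat_carrier[OF assms(2,3)] in
        \<open>auto simp: ring_mat_simps mult_mat_eq_0_if_std_part_0 std_part_of_real intro!: eq_matI\<close>)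
  ultimately show ?thesis by simp
qed

end
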